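(* Let $(X,B)$ be an $(r,k,\lambda)$-BIBD. Then for all subsets $P \subseteq X$ and $L \subseteq B$, the number $I(P,L)$ of incidences between $P$ and $L$ satisfies $$\left| I(P,L) - \frac{|P||L|r}{|B|} \right| \leq \sqrt{(r-\lambda)|P||L|}.$$
   Context: Let $X$ be a finite nonempty set (the points) and let $B$ be a set of subsets of $X$ (the blocks). For integers $r,k\ge 1$ and $\lambda \ge 0$, $(X,B)$ is an $(r,k,\lambda)$-BIBD (balanced incomplete block design) if: each point is in exactly $r$ blocks; each block contains exactly $k$ points; each pair of distinct points is contained in exactly $\lambda$ blocks; and no single block contains all of the points. A point $x\in X$ is incident to a block $b\in B$ if $x\in b$. For $P\subseteq X$ and $L\subseteq B$, $I(P,L) = |\{(x,b)\in P\times L : x\in b\}|$. *)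

theory Defs
  imports Complex_Main
begin

definition bibd :: "'a set \<Rightarrow> 'a set set \<Rightarrow> nat \<Rightarrow> nat \<Rightarrow> nat \<Rightarrow> bool" where
  "bibd X B r k lam \<longleftrightarrow>
     finite X \<and> X \<noteq> {} \<and> r \<ge> 1 \<and> k \<ge> 1 \<and>
     (\<forall>b\<in>B. b \<subseteq> X) \<and>
     (\<forall>x\<in>X. card {b \<in> B. x \<in> b} = r) \<and>
     (\<forall>b\<in>B. card b = k) \<and>
     (\<forall>x\<in>X. \<forall>y\<in>X. x \<noteq> y \<longrightarrow> card {b \<in> B. x \<in> b \<and> y \<in> b} = lam) \<and>
     (\<forall>b\<in>B. \<not> X \<subseteq> b)"

definition incidences :: "'a set \<Rightarrow> 'a set set \<Rightarrow> nat" where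
  "incidences P L = card {(x, b) \<in> P \<times> L. x \<in> b}"

end

theory Submission
  imports Defs "HOL-Analysis.Convex"
begin

text \<open>
  The proof is a variance estimate. Fix \<open>P\<close> and consider the block intersection sizes
  \<open>card (P \<inter> b)\<close>, whose mean over all blocks is \<open>r * card P / card B\<close>. The difference that has to
  be bounded is the sum, over the blocks in \<open>L\<close>, of the deviations from this mean
  (\<open>incidences_eq_sum_card\<close>). By Cauchy--Schwarz its square is at most \<open>card L\<close> times the total
  squared deviation, so it suffices that the latter is at most \<open>(r - lam) * card P\<close>.

  The first two moments of the intersection sizes depend only on \<open>card P\<close>, since the design
  conditions prescribe the number of blocks through one and through two points. Hence the total
  squared deviation is an explicit quadratic polynomial in \<open>card P\<close>
  (\<open>sum_squared_deviation\<close>), with linear coefficient \<open>r - lam\<close>. For \<open>P = X\<close> it vanishes, because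
  all blocks have the same size; as \<open>lam \<le> r\<close>, the quadratic coefficient is therefore not
  positive (\<open>bibd_lam_le_r_squared_div_card\<close>), and the bound follows.
\<close>

lemma real_card_Int_eq_sum:
  assumes "finite P"
  shows "real (card (P \<inter> b)) = (\<Sum>x\<in>P. of_bool (x \<in> b))"
  using assms by (simp add: Int_def)

lemma incidences_eq_sum_card:
  assumes "finite P" "finite L"
  shows "incidences P L = (\<Sum>b\<in>L. card (P \<inter> b))"
proof -
  have "{(x, b) \<in> P \<times> L. x \<in> b} = prod.swap ` (SIGMA b:L. P \<inter> b)"
    by (auto simp: image_iff)
  then have "incidences P L = card (SIGMA b:L. P \<inter> b)"
    by (simp add: incidences_def card_image)
  then show ?thesis
    using assms by simp
qed

text \<open>The two moments count the triples and pairs consisting of points of \<open>P\<close> and a block through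
  them; exchanging the summations expresses them by the numbers of blocks through given points.\<close>

lemma sum_card_Int_eq:
  assumes "finite P" "finite B"
  shows "(\<Sum>b\<in>B. real (card (P \<inter> b))) = (\<Sum>x\<in>P. real (card {b \<in> B. x \<in> b}))"
  unfolding real_card_Int_eq_sum[OF assms(1)]
  by (subst sum.swap) (use assms in \<open>simp add: Int_def\<close>)

lemma sum_card_Int_squared_eq:
  assumes "finite P" "finite B"
  shows "(\<Sum>b\<in>B. (real (card (P \<inter> b)))\<^sup>2) =
    (\<Sum>x\<in>P. \<Sum>y\<in>P. real (card {b \<in> B. x \<in> b \<and> y \<in> b}))"
proof -
  have "(\<Sum>b\<in>B. (real (card (P \<inter> b)))\<^sup>2) =
      (\<Sum>b\<in>B. \<Sum>x\<in>P. \<Sum>y\<in>P. of_bool (x \<in> b \<and> y \<in> b))"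
    unfolding real_card_Int_eq_sum[OF assms(1)] power2_eq_square sum_product
    by (simp only: of_bool_conj)
  also have "\<dots> = (\<Sum>x\<in>P. \<Sum>b\<in>B. \<Sum>y\<in>P. of_bool (x \<in> b \<and> y \<in> b))"
    by (rule sum.swap)
  also have "\<dots> = (\<Sum>x\<in>P. \<Sum>y\<in>P. \<Sum>b\<in>B. of_bool (x \<in> b \<and> y \<in> b))"
    by (intro sum.cong refl sum.swap)
  finally show ?thesis
    using assms by (simp add: Int_def)
qed

lemma bibd_finite_blocks:
  assumes "bibd X B r k lam"
  shows "finite B"
proof (rule finite_subset)
  show "B \<subseteq> Pow X" "finite (Pow X)"
    using assms by (auto simp: bibd_def)
qed

lemma bibd_card_blocks_pos:
  assumes "bibd X B r k lam"
  shows "card B > 0"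
proof -
  obtain x where "x \<in> X"
    using assms by (auto simp: bibd_def)
  then have "card {b \<in> B. x \<in> b} = r" "r \<ge> 1"
    using assms by (auto simp: bibd_def)
  then have "B \<noteq> {}"
    by auto
  then show ?thesis
    using bibd_finite_blocks[OF assms] by (simp add: card_gt_0_iff)
qed

text \<open>Comparing the blocks through two points with those through one of them requires two distinct
  points. They exist because some block through a given point misses another point.\<close>

lemma bibd_lam_le_r:
  assumes "bibd X B r k lam"
  shows "lam \<le> r"
proof -
  obtain x where x: "x \<in> X"
    using assms by (auto simp: bibd_def)
  then have "card {b \<in> B. x \<in> b} \<ge> 1"
    using assms by (auto simp: bibd_def)
  then have "{b \<in> B. x \<in> b} \<noteq> {}"
    by (metis card.empty not_one_le_zero)
  then obtain b where "b \<in> B" "x \<in> b"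
    by auto
  moreover have "\<not> X \<subseteq> b"
    using assms \<open>b \<in> B\<close> by (auto simp: bibd_def)
  ultimately obtain y where y: "y \<in> X" "x \<noteq> y"
    by auto
  have "card {b \<in> B. x \<in> b \<and> y \<in> b} \<le> card {b \<in> B. x \<in> b}"
    using bibd_finite_blocks[OF assms] by (intro card_mono) auto
  then show ?thesis
    using assms x y by (auto simp: bibd_def)
qed

lemma bibd_sum_card_Int:
  assumes "bibd X B r k lam" "P \<subseteq> X"
  shows "(\<Sum>b\<in>B. real (card (P \<inter> b))) = real r * real (card P)"
proof -
  have "finite P"
    using assms by (auto simp: bibd_def intro: finite_subset)
  moreover have "(\<Sum>x\<in>P. real (card {b \<in> B. x \<in> b})) = (\<Sum>x\<in>P. real r)"
    using assms by (intro sum.cong) (auto simp: bibd_def)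
  ultimately show ?thesis
    using bibd_finite_blocks[OF assms(1)] by (simp add: sum_card_Int_eq)
qed

lemma bibd_sum_card_Int_squared:
  assumes "bibd X B r k lam" "P \<subseteq> X"
  shows "(\<Sum>b\<in>B. (real (card (P \<inter> b)))\<^sup>2) =
    (real r - real lam) * real (card P) + real lam * (real (card P))\<^sup>2"
proof -
  have P: "finite P"
    using assms by (auto simp: bibd_def intro: finite_subset)
  have "real (card {b \<in> B. x \<in> b \<and> y \<in> b}) =
      real lam + (if x = y then real r - real lam else 0)" if "x \<in> P" "y \<in> P" for x y
    using assms that by (auto simp: bibd_def subset_iff)
  then have "(\<Sum>x\<in>P. \<Sum>y\<in>P. real (card {b \<in> B. x \<in> b \<and> y \<in> b})) =
      (\<Sum>x\<in>P. \<Sum>y\<in>P. real lam + (if x = y then real r - real lam else 0))"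
    by (intro sum.cong) auto
  also have "\<dots> = (\<Sum>x\<in>P. real (card P) * real lam + (real r - real lam))"
    using P by (intro sum.cong) (simp_all add: sum.distrib)
  finally show ?thesis
    unfolding sum_card_Int_squared_eq[OF P bibd_finite_blocks[OF assms(1)]]
    by (simp add: power2_eq_square algebra_simps)
qed

lemma sum_squared_deviation:
  assumes "bibd X B r k lam" "P \<subseteq> X"
  shows "(\<Sum>b\<in>B. (real (card (P \<inter> b)) - real r * real (card P) / real (card B))\<^sup>2) =
    (real r - real lam) * real (card P) +
    (real lam - (real r)\<^sup>2 / real (card B)) * (real (card P))\<^sup>2"
proof -
  define m where "m = real r * real (card P) / real (card B)"
  have m: "real (card B) * m = real r * real (card P)"
    using bibd_card_blocks_pos[OF assms(1)] by (simp add: m_def)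
  have "(\<Sum>b\<in>B. (real (card (P \<inter> b)) - m)\<^sup>2) =
      (\<Sum>b\<in>B. (real (card (P \<inter> b)))\<^sup>2 - 2 * m * real (card (P \<inter> b)) + m\<^sup>2)"
    by (simp add: power2_eq_square algebra_simps)
  also have "\<dots> = (\<Sum>b\<in>B. (real (card (P \<inter> b)))\<^sup>2)
      - 2 * m * (\<Sum>b\<in>B. real (card (P \<inter> b))) + (real (card B) * m) * m"
    by (simp add: sum.distrib sum_subtractf sum_distrib_left power2_eq_square)
  also have "\<dots> = (real r - real lam) * real (card P) + real lam * (real (card P))\<^sup>2
      - real r * real (card P) * m"
    unfolding m bibd_sum_card_Int[OF assms] bibd_sum_card_Int_squared[OF assms]
    by simp
  also have "\<dots> = (real r - real lam) * real (card P) +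
      (real lam - (real r)\<^sup>2 / real (card B)) * (real (card P))\<^sup>2"
    by (simp add: m_def power2_eq_square algebra_simps)
  finally show ?thesis
    by (simp add: m_def)
qed

text \<open>Every block meets the whole point set in exactly \<open>k\<close> points, so for \<open>P = X\<close> the squared
  deviations are all zero, and the quadratic coefficient in \<open>sum_squared_deviation\<close> equals
  \<open>- (r - lam) / card X\<close>.\<close>

lemma bibd_lam_le_r_squared_div_card:
  assumes "bibd X B r k lam"
  shows "real lam \<le> (real r)\<^sup>2 / real (card B)"
proof -
  define c where "c = real lam - (real r)\<^sup>2 / real (card B)"
  have k: "card (X \<inter> b) = k" if "b \<in> B" for b
  proof -
    have "X \<inter> b = b" "card b = k"
      using assms that by (auto simp: bibd_def)
    then show ?thesis by simp
  qed
  have "real (card B) * real k = real r * real (card X)"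
    using bibd_sum_card_Int[OF assms subset_refl] k by simp
  then have "real k = real r * real (card X) / real (card B)"
    using bibd_card_blocks_pos[OF assms] by (simp add: field_simps)
  then have "(\<Sum>b\<in>B. (real (card (X \<inter> b)) - real r * real (card X) / real (card B))\<^sup>2) = 0"
    by (intro sum.neutral) (simp add: k)
  then have eq: "(real r - real lam) * real (card X) + c * (real (card X))\<^sup>2 = 0"
    using sum_squared_deviation[OF assms subset_refl] by (simp add: c_def)
  have "card X > 0"
    using assms by (auto simp: bibd_def card_gt_0_iff)
  moreover have "(real r - real lam) * real (card X) \<ge> 0"
    using bibd_lam_le_r[OF assms] by simp
  ultimately have "c \<le> 0"
    using eq by (smt (verit) mult_pos_pos of_nat_0_less_iff zero_less_power)
  then show ?thesis
    by (simp add: c_def)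
qed

theorem theorem1:
  fixes X :: "'a set" and B :: "'a set set" and r k lam :: nat
    and P :: "'a set" and L :: "'a set set"
  assumes "bibd X B r k lam"
    and "P \<subseteq> X" and "L \<subseteq> B"
  shows "\<bar>real (incidences P L) - real (card P) * real (card L) * real r / real (card B)\<bar>
           \<le> sqrt ((real r - real lam) * real (card P) * real (card L))"
proof -
  define d where "d b = real (card (P \<inter> b)) - real r * real (card P) / real (card B)" for b
  have B: "finite B"
    by (rule bibd_finite_blocks[OF assms(1)])
  have fin: "finite P" "finite L"
    using assms B by (auto simp: bibd_def intro: finite_subset)
  have "real (incidences P L) - real (card P) * real (card L) * real r / real (card B) = sum d L"
    using fin by (simp add: incidences_eq_sum_card d_def sum_subtractf mult.commute)
  moreover have "(sum d L)\<^sup>2 \<le> (real r - real lam) * real (card P) * real (card L)"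
  proof -
    have "(sum d L)\<^sup>2 \<le> (\<Sum>b\<in>L. (d b)\<^sup>2) * real (card L)"
      by (rule sum_squared_le_sum_of_squares)
    also have "(\<Sum>b\<in>L. (d b)\<^sup>2) \<le> (\<Sum>b\<in>B. (d b)\<^sup>2)"
      using B assms(3) by (intro sum_mono2) auto
    also have "(\<Sum>b\<in>B. (d b)\<^sup>2) \<le> (real r - real lam) * real (card P)"
      unfolding d_def sum_squared_deviation[OF assms(1,2)]
      using bibd_lam_le_r_squared_div_card[OF assms(1)] by (simp add: mult_nonpos_nonneg)
    finally show ?thesis
      by (simp add: mult_right_mono)
  qed
  ultimately show ?thesis
    using real_le_rsqrt[of "\<bar>sum d L\<bar>"] by simp
qed

end
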